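(* Let the data, finite element spaces and forms be as described in the context, and assume that the potential energy density $W$ is a $C^1$ convex function. Let $\Delta t=T/N>0$ and let $(\mathbf u_h^n)_{n=0}^N\subset V_h$ and $(\mathbf X_h^n)_{n=0}^N\subset S_h$, together with $p_h^n\in Q_h$ and $\boldsymbol\lambda_h^n\in\Lambda_h$ for $n=1,\dots,N$, satisfy the following fully discrete problem: $\mathbf u_h^0=\mathbf u_{0h}$ and, for every $n=0,\dots,N-1$, $$\rho_f\Big(\frac{\mathbf u_h^{n+1}-\mathbf u_h^n}{\Delta t},\mathbf v\Big)+b(\mathbf u_h^n,\mathbf u_h^{n+1},\mathbf v)+a(\mathbf u_h^{n+1},\mathbf v)-(\operatorname{div}\mathbf v,p_h^{n+1})+\mathbf c_1(\boldsymbol\lambda_h^{n+1},\mathbf v(\mathbf X_h^n))=0\quad\forall \mathbf v\in V_h,$$ $$(\operatorname{div}\mathbf u_h^{n+1},q)=0\quad\forall q\in Q_h,$$ $$\delta\rho\Big(\frac{\mathbf X_h^{n+1}-2\mathbf X_h^n+\mathbf X_h^{n-1}}{\Delta t^2},\mathbf Y\Big)_{\mathcal B}+(\mathbb P(\mathbb F_h^{n+1}),\nabla_s\mathbf Y)_{\mathcal B}-\mathbf c_2(\boldsymbol\lambda_h^{n+1},\mathbf Y)=0\quad\forall\mathbf Y\in S_h,$$ $$\mathbf c_1(\boldsymbol\mu,\mathbf u_h^{n+1}(\mathbf X_h^n))-\mathbf c_2\Big(\boldsymbol\mu,\frac{\mathbf X_h^{n+1}-\mathbf X_h^n}{\Delta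 t}\Big)=0\quad\forall\boldsymbol\mu\in\Lambda_h,$$ where $\mathbb F_h^{n}=\nabla_s\mathbf X_h^{n}$. Then, with no restriction on $\Delta t$, for all $n=0,\dots,N-1$, $$\frac{\rho_f}{2\Delta t}\big(\|\mathbf u_h^{n+1}\|_0^2-\|\mathbf u_h^n\|_0^2\big)+\nu\|\boldsymbol\nabla_{\rm sym}\mathbf u_h^{n+1}\|_0^2+\frac{\delta\rho}{2\Delta t}\Big(\Big\|\frac{\mathbf X_h^{n+1}-\mathbf X_h^n}{\Delta t}\Big\|_{0,\mathcal B}^2-\Big\|\frac{\mathbf X_h^n-\mathbf X_h^{n-1}}{\Delta t}\Big\|_{0,\mathcal B}^2\Big)+\frac{E(\mathbf X_h^{n+1})-E(\mathbf X_h^n)}{\Delta t}\le 0.$$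
   Context: $\Omega\subset\mathbb R^d$, $d\in\{2,3\}$, is a bounded domain with Lipschitz boundary (containing fluid and structure); $\mathcal B\subset\mathbb R^m$ is the bounded reference domain of the structure, with $m=d$ (thick structure) or $m=d-1$ (thin structure). $(\cdot,\cdot)$ and $\|\cdot\|_0$ are the $L^2(\Omega)$ scalar product and norm, $(\cdot,\cdot)_{\mathcal B}$ and $\|\cdot\|_{0,\mathcal B}$ those of $L^2(\mathcal B)$ (vector- or tensor-valued, with $\mathbb D:\mathbb E=\sum_{\alpha,i}\mathbb D_{\alpha i}\mathbb E_{\alpha i}$). $L^2_0(\Omega)$ is the space of $L^2(\Omega)$ functions with zero mean. $\nabla_s$ is the gradient on $\mathcal B$. $T>0$ is the final time and $N$ the number of time steps. Constants: $\rho_f>0$ (fluid density), $\nu>0$ (viscosity), $\delta\rho\ge 0$ (excess density of the structure). Forms: $\boldsymbol\nabla_{\rm sym}\mathbf u=\nabla\mathbf u+(\nabla\mathbf u)^\top$, $a(\mathbf u,\mathbf v)=\nu(\boldsymbol\nabla_{\rm sym}\mathbf u,\boldsymbol\nabla_{\rm sym}\mathbf v)$, $b(\mathbf u,\mathbf v,\mathbf w)=\frac{\rho_f}{2}\big((\mathbf u\cdot\nabla\mathbf v,\mathbf w)-(\mathbf u\cdot\nabla\mathbf w,\mathbf v)\big)$. Elasticity: $W:\mathbb R^{d\times m}\to\mathbb R$ is a positive energy density, $\mathbb P(\mathbb F)=\partial W/\partial\mathbb F(\mathbb F)$, i.e. $\mathbb P_{\alpha i}=\partial W/\partial\mathbb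 F_{\alpha i}$, is the first Piola–Kirchhoff stress tensor, and $E(\mathbf X)=\int_{\mathcal B}W(\nabla_s\mathbf X(\mathbf s))\,d\mathbf s$ is the elastic potential energy. Multiplier space and coupling forms: $\Lambda$, $M_1$, $M_2$ are function spaces and $\mathbf c_1:\Lambda\times M_1\to\mathbb R$, $\mathbf c_2:\Lambda\times M_2\to\mathbb R$ are bilinear forms such that $\mathbf c_1(\boldsymbol\mu,\mathbf Z)-\mathbf c_2(\boldsymbol\mu,\mathbf Y)=0$ for all $\boldsymbol\mu\in\Lambda$ implies $\mathbf Z=\mathbf Y$ in $\mathcal B$. The choices are: for $m=d$, $M_1=M_2=(H^1(\mathcal B))^d$ and either $\Lambda=((H^1(\mathcal B))^d)'$ with $\mathbf c_1=\mathbf c_2$ the duality pairing, or $\Lambda=(H^1(\mathcal B))^d$ with $\mathbf c_1=\mathbf c_2$ the $(H^1(\mathcal B))^d$ scalar product; for $m=d-1$, $M_1=M_2=(H^{1/2}(\mathcal B))^d$, $\Lambda=((H^{1/2}(\mathcal B))^d)'$ and $\mathbf c_1=\mathbf c_2$ the duality pairing. Discrete spaces: $V_h\subseteq(H^1_0(\Omega))^d$ and $Q_h\subseteq L^2_0(\Omega)$ are finite element spaces (on a regular mesh of $\Omega$) satisfying the usual discrete ellipticity on the kernel and discrete inf-sup conditions for the Stokes problem; $S_h\subseteq(H^1(\mathcal B))^d$ (on a regular mesh of $\mathcal B$) and $\Lambda_h\subseteq\Lambda$ are finite dimensional subspaces. Conventions: for $\mathbf v\in V_h$, $\mathbf v(\mathbf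 X_h^n)$ denotes the composition $\mathbf v\circ\mathbf X_h^n$ on $\mathcal B$ (in the sense of traces if $m=d-1$), where $\mathbf X_h^n:\mathcal B\to\Omega$; as a standing assumption it is a well-defined element of $M_1$ depending linearly on $\mathbf v$, and the integrals appearing in the discrete problem are well defined. The initial data are $\mathbf u_{0h}\in V_h$ and $\mathbf X_0\in(W^{1,\infty}(\mathcal B))^d$; $\mathbf X_h^0\in S_h\cap (W^{1,\infty}(\mathcal B))^d$ is the discrete initial position corresponding to $\mathbf X_0$, and $\mathbf X_h^{-1}\in S_h$ is a prescribed starting value (for instance, formally, $\mathbf X_h^{-1}=0$). *)

theory Defs
  imports "HOL-Analysis.Analysis"
begin

section \<open>Domains, meshes and finite-dimensional function spaces\<close>

definition bounded_domain :: "'a::euclidean_space set \<Rightarrow> bool" where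
  "bounded_domain U \<longleftrightarrow> open U \<and> connected U \<and> bounded U \<and> U \<noteq> {}"

text \<open>Near each boundary point, \<open>U\<close> is the strict epigraph of a Lipschitz function in the
  direction of a unit vector \<open>e\<close>; \<open>\<gamma>\<close> is only evaluated on the hyperplane orthogonal to \<open>e\<close>.\<close>

definition lipschitz_boundary :: "'a::euclidean_space set \<Rightarrow> bool" where
  "lipschitz_boundary U \<longleftrightarrow>
    (\<forall>z\<in>frontier U. \<exists>r>0. \<exists>e (\<gamma>::'a \<Rightarrow> real) L. norm e = 1 \<and> L-lipschitz_on UNIV \<gamma> \<and>
      U \<inter> ball z r = {x \<in> ball z r. \<gamma> (x - (x \<bullet> e) *\<^sub>R e) < x \<bullet> e})"

text \<open>Elements are arbitrary compact sets (simplices, hexahedra, curved elements, ...); regularity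
  is the usual bound \<open>\<sigma>\<close> on the ratio between diameter and radius of an inscribed ball.\<close>

definition regular_mesh :: "real \<Rightarrow> 'a::euclidean_space set \<Rightarrow> 'a set set \<Rightarrow> bool" where
  "regular_mesh \<sigma> U \<T> \<longleftrightarrow> finite \<T> \<and> \<Union>\<T> = closure U \<and>
    pairwise (\<lambda>K L. interior K \<inter> interior L = {}) \<T> \<and>
    (\<forall>K\<in>\<T>. compact K \<and> (\<exists>x r. 0 < r \<and> cball x r \<subseteq> K \<and> diameter K \<le> \<sigma> * r))"

text \<open>The next two notions apply to spaces of functions and, with \<open>'a\<close> itself a function type, to
  spaces of functionals.\<close>

definition lin_subspace :: "('a \<Rightarrow> 'b::real_vector) set \<Rightarrow> bool" where
  "lin_subspace V \<longleftrightarrow> V \<noteq> {} \<and>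
    (\<forall>f\<in>V. \<forall>g\<in>V. \<forall>a b::real. (\<lambda>x. a *\<^sub>R f x + b *\<^sub>R g x) \<in> V)"

definition fin_dim :: "('a \<Rightarrow> 'b::real_vector) set \<Rightarrow> bool" where
  "fin_dim V \<longleftrightarrow> (\<exists>S\<subseteq>V. finite S \<and>
    (\<forall>v\<in>V. \<exists>c::('a \<Rightarrow> 'b) \<Rightarrow> real. v = (\<lambda>x. \<Sum>b\<in>S. c b *\<^sub>R b x)))"

text \<open>A finite element space in the general sense of Ciarlet: finitely many degrees of freedom and
  functions that are continuous up to the boundary on each element. Global conformity is imposed
  separately, through the Sobolev space containing the finite element space.\<close>

definition fe_space :: "'a::euclidean_space set set \<Rightarrow> ('a \<Rightarrow> 'b::real_normed_vector) set \<Rightarrow> bool" where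
  "fe_space \<T> V \<longleftrightarrow> lin_subspace V \<and> fin_dim V \<and>
    (\<forall>v\<in>V. \<forall>K\<in>\<T>. \<exists>g. continuous_on K g \<and> (\<forall>x\<in>interior K. v x = g x))"

section \<open>Lebesgue and Sobolev spaces\<close>

text \<open>Elements of Lebesgue and Sobolev spaces on \<open>U\<close> are represented by functions on the whole
  Euclidean space of which only the values on \<open>U\<close>, up to null sets, are relevant.\<close>

definition L2 :: "'a::euclidean_space set \<Rightarrow> ('a \<Rightarrow> 'b::euclidean_space) set" where
  "L2 U = {f. f \<in> borel_measurable (lebesgue_on U) \<and>
              integrable (lebesgue_on U) (\<lambda>x. (norm (f x))\<^sup>2)}"

text \<open>On matrix-valued functions the library's inner product is the Frobenius product.\<close>

definition L2_inner ::
    "'a::euclidean_space set \<Rightarrow> ('a \<Rightarrow> 'b::euclidean_space) \<Rightarrow> ('a \<Rightarrow> 'b) \<Rightarrow> real" where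
  "L2_inner U f g = (LINT x|lebesgue_on U. f x \<bullet> g x)"

definition L2_norm_on :: "'a::euclidean_space set \<Rightarrow> ('a \<Rightarrow> 'b::euclidean_space) \<Rightarrow> real" where
  "L2_norm_on U f = sqrt (L2_inner U f f)"

definition L2_zero_mean :: "'a::euclidean_space set \<Rightarrow> ('a \<Rightarrow> real) set" where
  "L2_zero_mean U = {q \<in> L2 U. (LINT x|lebesgue_on U. q x) = 0}"

definition Linf :: "'a::euclidean_space set \<Rightarrow> ('a \<Rightarrow> 'b::euclidean_space) set" where
  "Linf U = {f. f \<in> borel_measurable (lebesgue_on U) \<and>
                (\<exists>C. AE x in lebesgue_on U. norm (f x) \<le> C)}"

definition L1_loc :: "'a::euclidean_space set \<Rightarrow> ('a \<Rightarrow> 'b::euclidean_space) set" where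
  "L1_loc U = {f. f \<in> borel_measurable (lebesgue_on U) \<and>
                  (\<forall>K. compact K \<and> K \<subseteq> U \<longrightarrow> integrable (lebesgue_on K) f)}"

primrec Ck :: "nat \<Rightarrow> ('a::euclidean_space \<Rightarrow> real) \<Rightarrow> bool" where
  "Ck 0 f \<longleftrightarrow> continuous_on UNIV f"
| "Ck (Suc k) f \<longleftrightarrow> (\<forall>x. f differentiable (at x)) \<and>
     (\<forall>i\<in>Basis. Ck k (\<lambda>x. frechet_derivative f (at x) i))"

definition test_function :: "'a::euclidean_space set \<Rightarrow> ('a \<Rightarrow> real) \<Rightarrow> bool" where
  "test_function U \<phi> \<longleftrightarrow> (\<forall>k. Ck k \<phi>) \<and>
    (\<exists>K. compact K \<and> K \<subseteq> U \<and> (\<forall>x. x \<notin> K \<longrightarrow> \<phi> x = 0))"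

text \<open>The entry \<open>G x $ \<alpha> $ i\<close> is the weak derivative of component \<open>\<alpha>\<close> in direction \<open>i\<close>.\<close>

definition has_weak_grad ::
    "(real^'m) set \<Rightarrow> (real^'m \<Rightarrow> real^'d) \<Rightarrow> (real^'m \<Rightarrow> real^'m^'d) \<Rightarrow> bool" where
  "has_weak_grad U f G \<longleftrightarrow> f \<in> L1_loc U \<and> G \<in> L1_loc U \<and>
    (\<forall>\<phi>. test_function U \<phi> \<longrightarrow> (\<forall>\<alpha> i.
      (LINT x|lebesgue_on U. f x $ \<alpha> * frechet_derivative \<phi> (at x) (axis i 1)) =
      - (LINT x|lebesgue_on U. G x $ \<alpha> $ i * \<phi> x)))"

definition weak_grad :: "(real^'m) set \<Rightarrow> (real^'m \<Rightarrow> real^'d) \<Rightarrow> real^'m \<Rightarrow> real^'m^'d" where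
  "weak_grad U f = (SOME G. has_weak_grad U f G)"

definition H1 :: "(real^'m) set \<Rightarrow> (real^'m \<Rightarrow> real^'d) set" where
  "H1 U = {f \<in> L2 U. \<exists>G\<in>L2 U. has_weak_grad U f G}"

definition H1_inner :: "(real^'m) set \<Rightarrow> (real^'m \<Rightarrow> real^'d) \<Rightarrow> (real^'m \<Rightarrow> real^'d) \<Rightarrow> real" where
  "H1_inner U f g = L2_inner U f g + L2_inner U (weak_grad U f) (weak_grad U g)"

definition H1_norm :: "(real^'m) set \<Rightarrow> (real^'m \<Rightarrow> real^'d) \<Rightarrow> real" where
  "H1_norm U f = sqrt (H1_inner U f f)"

definition H10 :: "(real^'m) set \<Rightarrow> (real^'m \<Rightarrow> real^'d) set" where
  "H10 U = {f \<in> H1 U. \<exists>\<phi> :: nat \<Rightarrow> real^'m \<Rightarrow> real^'d.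
      (\<forall>k \<alpha>. test_function U (\<lambda>x. \<phi> k x $ \<alpha>)) \<and>
      (\<lambda>k. H1_norm U (\<lambda>x. f x - \<phi> k x)) \<longlonglongrightarrow> 0}"

definition W1inf :: "(real^'m) set \<Rightarrow> (real^'m \<Rightarrow> real^'d) set" where
  "W1inf U = {f \<in> Linf U. \<exists>G\<in>Linf U. has_weak_grad U f G}"

text \<open>The fractional space of order one half, with the Sobolev-Slobodeckij seminorm: the exponent
  of the kernel is the dimension plus twice the order.\<close>

definition Hhalf_seminorm_sq :: "(real^'m) set \<Rightarrow> (real^'m \<Rightarrow> real^'d) \<Rightarrow> ennreal" where
  "Hhalf_seminorm_sq U f =
    (\<integral>\<^sup>+x. (\<integral>\<^sup>+y. ennreal ((norm (f x - f y))\<^sup>2 / norm (x - y) ^ (CARD('m) + 1))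
       \<partial>lebesgue_on U) \<partial>lebesgue_on U)"

definition Hhalf :: "(real^'m) set \<Rightarrow> (real^'m \<Rightarrow> real^'d) set" where
  "Hhalf U = {f \<in> L2 U. Hhalf_seminorm_sq U f < \<infinity>}"

definition Hhalf_norm :: "(real^'m) set \<Rightarrow> (real^'m \<Rightarrow> real^'d) \<Rightarrow> real" where
  "Hhalf_norm U f = sqrt (L2_inner U f f + enn2real (Hhalf_seminorm_sq U f))"

text \<open>Functionals vanish outside \<open>M\<close> so that each one has a single representative; boundedness
  makes them invariant under changes on null sets.\<close>

definition dual_space ::
    "('a \<Rightarrow> 'b::real_vector) set \<Rightarrow> (('a \<Rightarrow> 'b) \<Rightarrow> real) \<Rightarrow> (('a \<Rightarrow> 'b) \<Rightarrow> real) set" where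
  "dual_space M nrm = {l.
     (\<forall>f\<in>M. \<forall>g\<in>M. \<forall>a b. l (\<lambda>x. a *\<^sub>R f x + b *\<^sub>R g x) = a * l f + b * l g) \<and>
     (\<exists>C. \<forall>f\<in>M. \<bar>l f\<bar> \<le> C * nrm f) \<and>
     (\<forall>f. f \<notin> M \<longrightarrow> l f = 0)}"

section \<open>Fluid forms\<close>

definition weak_div :: "(real^'d) set \<Rightarrow> (real^'d \<Rightarrow> real^'d) \<Rightarrow> real^'d \<Rightarrow> real" where
  "weak_div U v x = trace (weak_grad U v x)"

text \<open>The symmetrized gradient carries no factor one half.\<close>

definition sym_grad :: "(real^'d) set \<Rightarrow> (real^'d \<Rightarrow> real^'d) \<Rightarrow> real^'d \<Rightarrow> real^'d^'d" where
  "sym_grad U v x = weak_grad U v x + transpose (weak_grad U v x)"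

definition a_form ::
    "real \<Rightarrow> (real^'d) set \<Rightarrow> (real^'d \<Rightarrow> real^'d) \<Rightarrow> (real^'d \<Rightarrow> real^'d) \<Rightarrow> real" where
  "a_form \<nu> U u v = \<nu> * L2_inner U (sym_grad U u) (sym_grad U v)"

definition b_form ::
    "real \<Rightarrow> (real^'d) set \<Rightarrow> (real^'d \<Rightarrow> real^'d) \<Rightarrow> (real^'d \<Rightarrow> real^'d) \<Rightarrow>
      (real^'d \<Rightarrow> real^'d) \<Rightarrow> real" where
  "b_form \<rho> U u v w = \<rho> / 2 *
     (L2_inner U (\<lambda>x. weak_grad U v x *v u x) w - L2_inner U (\<lambda>x. weak_grad U w x *v u x) v)"

definition discrete_kernel_elliptic ::
    "real \<Rightarrow> (real^'d) set \<Rightarrow> (real^'d \<Rightarrow> real^'d) set \<Rightarrow> (real^'d \<Rightarrow> real) set \<Rightarrow> bool" where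
  "discrete_kernel_elliptic \<nu> U Vh Qh \<longleftrightarrow>
    (\<exists>\<alpha>>0. \<forall>v\<in>Vh. (\<forall>q\<in>Qh. L2_inner U (weak_div U v) q = 0) \<longrightarrow>
       \<alpha> * (H1_norm U v)\<^sup>2 \<le> a_form \<nu> U v v)"

text \<open>Functions of norm zero contribute the value zero to the supremum, which is harmless.\<close>

definition discrete_inf_sup ::
    "(real^'d) set \<Rightarrow> (real^'d \<Rightarrow> real^'d) set \<Rightarrow> (real^'d \<Rightarrow> real) set \<Rightarrow> bool" where
  "discrete_inf_sup U Vh Qh \<longleftrightarrow>
    (\<exists>\<beta>>0. \<forall>q\<in>Qh. ereal (\<beta> * L2_norm_on U q) \<le>
       (SUP v\<in>Vh. ereal (L2_inner U (weak_div U v) q / H1_norm U v)))"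

section \<open>Elasticity\<close>

definition piola :: "(real^'m^'d \<Rightarrow> real) \<Rightarrow> real^'m^'d \<Rightarrow> real^'m^'d" where
  "piola W F = (\<chi> \<alpha> i. deriv (\<lambda>t. W (F + t *\<^sub>R axis \<alpha> (axis i 1))) 0)"

definition elastic_energy ::
    "(real^'m) set \<Rightarrow> (real^'m^'d \<Rightarrow> real) \<Rightarrow> (real^'m \<Rightarrow> real^'d) \<Rightarrow> real" where
  "elastic_energy B W X = (LINT s|lebesgue_on B. W (weak_grad B X s))"

section \<open>Multiplier spaces and coupling forms\<close>

text \<open>Depending on the choice of the multiplier space, multipliers are functionals or fields; the
  tags allow both cases to share one type.\<close>

datatype 'f multiplier = Functional "'f \<Rightarrow> real" | Field 'f

definition multiplier_subspace ::
    "('a \<Rightarrow> 'b::real_vector) multiplier set \<Rightarrow> ('a \<Rightarrow> 'b) multiplier set \<Rightarrow> bool" where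
  "multiplier_subspace \<Lambda>h \<Lambda> \<longleftrightarrow> \<Lambda>h \<subseteq> \<Lambda> \<and>
    ((\<exists>L. lin_subspace L \<and> fin_dim L \<and> \<Lambda>h = Functional ` L) \<or>
     (\<exists>L. lin_subspace L \<and> fin_dim L \<and> \<Lambda>h = Field ` L))"

text \<open>The thick structure with the duality pairing, the thick structure with the scalar product,
  and the thin structure with the duality pairing.\<close>

definition coupling_choice ::
    "(real^'m) set \<Rightarrow> (real^'m \<Rightarrow> real^'d) multiplier set \<Rightarrow>
     (real^'m \<Rightarrow> real^'d) set \<Rightarrow> (real^'m \<Rightarrow> real^'d) set \<Rightarrow>
     ((real^'m \<Rightarrow> real^'d) multiplier \<Rightarrow> (real^'m \<Rightarrow> real^'d) \<Rightarrow> real) \<Rightarrow>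
     ((real^'m \<Rightarrow> real^'d) multiplier \<Rightarrow> (real^'m \<Rightarrow> real^'d) \<Rightarrow> real) \<Rightarrow> bool" where
  "coupling_choice B \<Lambda> M1 M2 c1 c2 \<longleftrightarrow>
    (CARD('m) = CARD('d) \<and> M1 = H1 B \<and> M2 = H1 B \<and>
       \<Lambda> = Functional ` dual_space (H1 B) (H1_norm B) \<and>
       (\<forall>l Y. c1 (Functional l) Y = l Y \<and> c2 (Functional l) Y = l Y)) \<or>
    (CARD('m) = CARD('d) \<and> M1 = H1 B \<and> M2 = H1 B \<and>
       \<Lambda> = Field ` H1 B \<and>
       (\<forall>\<mu> Y. c1 (Field \<mu>) Y = H1_inner B \<mu> Y \<and> c2 (Field \<mu>) Y = H1_inner B \<mu> Y)) \<or>
    (CARD('m) + 1 = CARD('d) \<and> M1 = Hhalf B \<and> M2 = Hhalf B \<and>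
       \<Lambda> = Functional ` dual_space (Hhalf B) (Hhalf_norm B) \<and>
       (\<forall>l Y. c1 (Functional l) Y = l Y \<and> c2 (Functional l) Y = l Y))"

definition coupling_separates ::
    "(real^'m) set \<Rightarrow> (real^'m \<Rightarrow> real^'d) multiplier set \<Rightarrow>
     (real^'m \<Rightarrow> real^'d) set \<Rightarrow> (real^'m \<Rightarrow> real^'d) set \<Rightarrow>
     ((real^'m \<Rightarrow> real^'d) multiplier \<Rightarrow> (real^'m \<Rightarrow> real^'d) \<Rightarrow> real) \<Rightarrow>
     ((real^'m \<Rightarrow> real^'d) multiplier \<Rightarrow> (real^'m \<Rightarrow> real^'d) \<Rightarrow> real) \<Rightarrow> bool" where
  "coupling_separates B \<Lambda> M1 M2 c1 c2 \<longleftrightarrow>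
    (\<forall>Z\<in>M1. \<forall>Y\<in>M2. (\<forall>\<mu>\<in>\<Lambda>. c1 \<mu> Z - c2 \<mu> Y = 0) \<longrightarrow> (AE s in lebesgue_on B. Z s = Y s))"

end

(* Testing with v = u^{n+1}, q = p^{n+1}, mu = lambda^{n+1} and Y = (X^{n+1} - X^n)/dt makes the
   pressure, convection and coupling terms cancel; the time differences are bounded below by
   2 (x - y) . x >= |x|^2 - |y|^2 and the stress term by the subgradient inequality
   P(F) : (F - G) >= W(F) - W(G).

   The analytic points are that the chosen weak gradient is linear almost everywhere, which follows
   from the fundamental lemma of the calculus of variations, and that the energies are finite (a
   divergent integral would have the junk value 0): W(F) <= W(0) + P(F) : F bounds the energy density
   by the integrable stress power for n >= 1, and X^0 is W^{1,infinity}. *)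

theory Submission
  imports Defs
begin

section \<open>Smooth bump functions on boxes\<close>

lemma Ck_const: "Ck k (\<lambda>x. c)"
  by (induction k arbitrary: c) (simp_all add: frechet_derivative_const)

text \<open>The product rule leaves undifferentiated factors behind, which must count as smooth of
  the lower order. The same fact gives continuity of a \<open>Ck 1\<close> energy density.\<close>

lemma Ck_Suc_imp_Ck: "Ck (Suc k) f \<Longrightarrow> Ck k f"
proof (induction k arbitrary: f)
  case 0
  then show ?case
    by (auto simp: continuous_on_eq_continuous_at intro: differentiable_imp_continuous_within)
qed auto

lemma Ck_add:
  assumes "Ck k f" "Ck k g"
  shows "Ck k (\<lambda>x. f x + g x)"
  using assms
proof (induction k arbitrary: f g)
  case 0
  then show ?case by (simp add: continuous_on_add)
next
  case (Suc k)
  have "frechet_derivative (\<lambda>x. f x + g x) (at x) =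
      (\<lambda>h. frechet_derivative f (at x) h + frechet_derivative g (at x) h)" for x
    using Suc.prems
    by (intro frechet_derivative_at[symmetric] has_derivative_add)
       (auto simp flip: frechet_derivative_works)
  with Suc show ?case by simp
qed

lemma Ck_mult:
  assumes "Ck k f" "Ck k g"
  shows "Ck k (\<lambda>x. f x * g x)"
  using assms
proof (induction k arbitrary: f g)
  case 0
  then show ?case by (simp add: continuous_on_mult)
next
  case (Suc k)
  have "frechet_derivative (\<lambda>x. f x * g x) (at x) =
      (\<lambda>h. f x * frechet_derivative g (at x) h + frechet_derivative f (at x) h * g x)" for x
    using Suc.prems
    by (intro frechet_derivative_at[symmetric] has_derivative_mult)
       (auto simp flip: frechet_derivative_works)
  moreover have "Ck k f" "Ck k g"
    using Suc.prems Ck_Suc_imp_Ck by blast+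
  ultimately show ?case
    using Suc by (auto intro!: Ck_add)
qed

lemma Ck_prod:
  "(\<And>i. i \<in> I \<Longrightarrow> Ck k (f i)) \<Longrightarrow> Ck k (\<lambda>x. \<Prod>i\<in>I. f i x)"
  by (induction I rule: infinite_finite_induct) (auto intro: Ck_const Ck_mult)

text \<open>The extra power in the denominator makes this family closed under differentiation up to
  linear combinations, so smoothness follows by induction on the order.\<close>

definition flat_exp :: "nat \<Rightarrow> real \<Rightarrow> real" where
  "flat_exp n t = (if t > 0 then exp (- 1 / t) / t ^ n else 0)"

text \<open>From the right, the substitution s = 1/t turns the limit into that of s^n / exp s at
  infinity; from the left the function is identically zero.\<close>

lemma flat_exp_tendsto_0: "(flat_exp n \<longlongrightarrow> 0) (at 0)"
proof -
  have "((\<lambda>t. (1 / t) ^ n / exp (1 / t)) \<longlongrightarrow> 0) (at_right (0::real))"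
    by (rule filterlim_compose[OF tendsto_power_div_exp_0])
       (simp add: filterlim_inverse_at_top_right flip: inverse_eq_divide)
  then have "(flat_exp n \<longlongrightarrow> 0) (at_right 0)"
    by (rule Lim_transform_eventually)
       (auto simp: eventually_at_filter flat_exp_def exp_minus field_simps)
  moreover have "(flat_exp n \<longlongrightarrow> 0) (at_left 0)"
    by (rule Lim_transform_eventually[OF tendsto_const])
       (auto simp: eventually_at_filter flat_exp_def)
  ultimately show ?thesis
    by (simp add: filterlim_at_split)
qed

lemma DERIV_flat_exp:
  "DERIV (flat_exp n) t :> flat_exp (n + 2) t - real n * flat_exp (n + 1) t"
proof -
  consider "t < 0" | "t = 0" | "t > 0" by linarith
  then show ?thesis
  proof cases
    case 1
    have "DERIV (\<lambda>t. 0) t :> (0::real)" by simp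
    then have "DERIV (flat_exp n) t :> 0"
      by (rule has_field_derivative_transform_within_open[of _ _ _ "{..<0}"])
         (use 1 in \<open>auto simp: flat_exp_def\<close>)
    then show ?thesis using 1 by (simp add: flat_exp_def)
  next
    case 2
    \<comment> \<open>Away from 0 the difference quotient at the origin is
      \<open>flat_exp (Suc n) h\<close>, because dividing by h only raises the power in the
      denominator.\<close>
    have "((\<lambda>h. (flat_exp n (0 + h) - flat_exp n 0) / h) \<longlongrightarrow> 0) (at 0)"
      by (rule Lim_transform_eventually[OF flat_exp_tendsto_0[of "Suc n"]])
         (auto simp: eventually_at_filter flat_exp_def field_simps)
    then show ?thesis using 2 by (simp add: DERIV_def flat_exp_def)
  next
    case 3
    have "DERIV (\<lambda>t. exp (- 1 / t)) t :> exp (- 1 / t) / t\<^sup>2"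
      using 3 by (auto intro!: derivative_eq_intros simp: power2_eq_square)
    \<comment> \<open>Writing the derivative with \<open>t ^ n / t\<close> treats n = 0 uniformly,
      without the truncated exponent n - 1.\<close>
    moreover have "DERIV (\<lambda>t. t ^ n) t :> real n * t ^ n / t"
      by (rule DERIV_cong[OF DERIV_power[OF DERIV_ident]]) (use 3 in \<open>cases n; simp\<close>)
    ultimately have "DERIV (\<lambda>t. exp (- 1 / t) / t ^ n) t :>
        (exp (- 1 / t) / t\<^sup>2 * t ^ n - exp (- 1 / t) * (real n * t ^ n / t)) / (t ^ n * t ^ n)"
      using 3 by (intro DERIV_divide) auto
    also have "(exp (- 1 / t) / t\<^sup>2 * t ^ n - exp (- 1 / t) * (real n * t ^ n / t)) / (t ^ n * t ^ n) =
        exp (- 1 / t) / t ^ (n + 2) - real n * (exp (- 1 / t) / t ^ (n + 1))"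
      using 3 by (simp add: field_simps power2_eq_square)
    finally have "DERIV (\<lambda>t. exp (- 1 / t) / t ^ n) t :>
        exp (- 1 / t) / t ^ (n + 2) - real n * (exp (- 1 / t) / t ^ (n + 1))" .
    then have "DERIV (flat_exp n) t :>
        exp (- 1 / t) / t ^ (n + 2) - real n * (exp (- 1 / t) / t ^ (n + 1))"
      by (rule has_field_derivative_transform_within_open[of _ _ _ "{0<..}"])
         (use 3 in \<open>auto simp: flat_exp_def\<close>)
    then show ?thesis using 3 by (simp add: flat_exp_def)
  qed
qed

text \<open>Differentiating in direction i stays inside the family: it raises n by one or two and
  multiplies by the constant \<open>v \<bullet> i\<close>. Hence the induction on k keeps n
  arbitrary.\<close>

lemma Ck_flat_exp_affine: "Ck k (\<lambda>x. flat_exp n (v \<bullet> x + d))"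
proof (induction k arbitrary: n)
  case 0
  have "continuous_on UNIV (flat_exp n)"
    using DERIV_flat_exp DERIV_isCont continuous_at_imp_continuous_on by blast
  then show ?case
    by (auto intro!: continuous_intros continuous_on_compose2[of UNIV "flat_exp n"])
next
  case (Suc k)
  let ?D = "\<lambda>x. flat_exp (n + 2) (v \<bullet> x + d) - real n * flat_exp (n + 1) (v \<bullet> x + d)"
  have D: "((\<lambda>x. flat_exp n (v \<bullet> x + d)) has_derivative (\<lambda>h. ?D x * (v \<bullet> h))) (at x)" for x
  proof (rule has_derivative_compose[where f = "\<lambda>x. v \<bullet> x + d" and f' = "\<lambda>h. v \<bullet> h" and g' = "(*) (?D x)"])
    show "((\<lambda>x. v \<bullet> x + d) has_derivative (\<lambda>h. v \<bullet> h)) (at x)"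
      by (auto intro!: derivative_eq_intros)
    show "(flat_exp n has_derivative (*) (?D x)) (at (v \<bullet> x + d))"
      using DERIV_flat_exp[of n "v \<bullet> x + d"] by (simp add: has_field_derivative_def)
  qed
  have "Ck k (\<lambda>x. (flat_exp (n + 2) (v \<bullet> x + d) + (- real n) * flat_exp (n + 1) (v \<bullet> x + d))
      * (v \<bullet> i))" for i
    by (intro Ck_mult Ck_add Ck_const Suc.IH)
  moreover have "frechet_derivative (\<lambda>x. flat_exp n (v \<bullet> x + d)) (at x) = (\<lambda>h. ?D x * (v \<bullet> h))" for x
    using frechet_derivative_at[OF D] by simp
  ultimately show ?case
    using D by (auto intro: differentiableI)
qed

text \<open>The parameter k is a sharpness: for t > 0 the factor \<open>exp (- 1 / (k * t))\<close>
  increases to 1, so the bumps approach the indicator of the open box while their support never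
  grows.\<close>

definition box_bump :: "'a::euclidean_space \<Rightarrow> 'a \<Rightarrow> nat \<Rightarrow> 'a \<Rightarrow> real" where
  "box_bump a b k x =
    (\<Prod>i\<in>Basis. flat_exp 0 (real k * (x \<bullet> i - a \<bullet> i)) * flat_exp 0 (real k * (b \<bullet> i - x \<bullet> i)))"

lemma box_bump_eq_0:
  assumes "x \<notin> box a b"
  shows "box_bump a b k x = 0"
proof -
  obtain i where "i \<in> Basis" "x \<bullet> i \<le> a \<bullet> i \<or> b \<bullet> i \<le> x \<bullet> i"
    using assms by (auto simp: mem_box not_less)
  then show ?thesis
    by (auto simp: box_bump_def flat_exp_def zero_less_mult_iff intro!: bexI[of _ i])
qed

text \<open>The bump vanishes off an open box, whereas a test function must vanish off a compact
  subset of \<open>U\<close>; the set \<open>K\<close> bridges the two.\<close>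

lemma test_function_box_bump:
  assumes "box a b \<subseteq> K" "compact K" "K \<subseteq> U"
  shows "test_function U (box_bump a b k)"
proof -
  have "Ck j (\<lambda>x. flat_exp 0 (real k * (x \<bullet> i - a \<bullet> i)))"
      "Ck j (\<lambda>x. flat_exp 0 (real k * (b \<bullet> i - x \<bullet> i)))" for j and i :: 'a
    using Ck_flat_exp_affine[of j 0 "real k *\<^sub>R i" "- (real k * (a \<bullet> i))"]
      Ck_flat_exp_affine[of j 0 "- real k *\<^sub>R i" "real k * (b \<bullet> i)"]
    by (simp_all add: inner_commute right_diff_distrib)
  then have "Ck j (box_bump a b k)" for j
    unfolding box_bump_def[abs_def] by (intro Ck_prod Ck_mult)
  then show ?thesis
    using assms box_bump_eq_0[of _ a b k]
    by (auto simp: test_function_def intro!: exI[of _ K])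
qed

lemma box_bump_bounded: "0 \<le> box_bump a b k x" "box_bump a b k x \<le> 1"
proof -
  have *: "0 \<le> flat_exp 0 t" "flat_exp 0 t \<le> 1" for t
    by (auto simp: flat_exp_def)
  then show "0 \<le> box_bump a b k x" "box_bump a b k x \<le> 1"
    unfolding box_bump_def by (auto intro!: prod_nonneg prod_le_1 mult_le_one)
qed

lemma box_bump_tendsto_indicator: "(\<lambda>k. box_bump a b k x) \<longlonglongrightarrow> indicator (box a b) x"
proof (cases "x \<in> box a b")
  case True
  have *: "(\<lambda>k. flat_exp 0 (real k * t)) \<longlonglongrightarrow> 1" if "t > 0" for t
  proof (rule Lim_transform_eventually)
    show "(\<lambda>k. exp (- (inverse t * inverse (real k)))) \<longlonglongrightarrow> 1"
      using tendsto_exp[OF tendsto_minus[OF tendsto_mult_left[OF lim_inverse_n, of "inverse t"]]]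
      by simp
    show "\<forall>\<^sub>F k in sequentially. exp (- (inverse t * inverse (real k))) = flat_exp 0 (real k * t)"
      \<comment> \<open>At k = 0 the two sides are 1 and 0, so the equality holds only
        eventually.\<close>
      using eventually_gt_at_top[of 0]
      by eventually_elim (use that in \<open>simp add: flat_exp_def field_simps\<close>)
  qed
  have "(\<lambda>k. box_bump a b k x) \<longlonglongrightarrow> (\<Prod>i\<in>(Basis::'a set). 1 * 1)"
    unfolding box_bump_def
    by (intro tendsto_prod tendsto_mult *) (use True in \<open>auto simp: mem_box\<close>)
  then show ?thesis using True by simp
qed (simp add: box_bump_eq_0)

section \<open>The fundamental lemma of the calculus of variations\<close>

text \<open>Boxes form an intersection-stable generator of the Borel sets, so a Dynkin argument
  carries the vanishing of the integral from boxes to all Borel sets, which forces the function to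
  vanish almost everywhere.\<close>

lemma AE_eq_0_if_box_integrals_eq_0:
  fixes g :: "'a::euclidean_space \<Rightarrow> real"
  assumes g: "integrable lebesgue g"
    and box0: "\<And>a b. (LINT x|lebesgue. indicator (box a b) x * g x) = 0"
  shows "AE x in lebesgue. g x = 0"
proof -
  \<comment> \<open>The Dynkin argument reaches Borel sets only, so \<open>g\<close> is first
    replaced by a Borel representative.\<close>
  obtain g' where g': "g' \<in> borel_measurable lborel" and "AE x in lborel. g x = g' x"
    using completion_ex_borel_measurable_real[of g lborel] borel_measurable_integrable[OF g]
    by auto
  then have eq: "AE x in lebesgue. g x = g' x"
    by (auto intro: AE_completion)
  have [measurable]: "g' \<in> borel_measurable borel" "g' \<in> borel_measurable lebesgue"
      "g \<in> borel_measurable lebesgue"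
    using g' borel_measurable_integrable[OF g] by (simp_all add: measurable_completion)
  have "integrable lebesgue g'"
    using g integrable_cong_AE[OF _ _ eq] by simp
  then have int: "integrable lborel g'"
    using g' by (simp add: integrable_completion)
  have box0': "(LINT x:box a b|lborel. g' x) = 0" for a b
  proof -
    have "(LINT x:box a b|lborel. g' x) = (LINT x|lebesgue. indicator (box a b) x * g' x)"
      unfolding set_lebesgue_integral_def by (subst integral_completion) auto
    also have "\<dots> = (LINT x|lebesgue. indicator (box a b) x * g x)"
      using eq by (intro integral_cong_AE) (auto intro!: borel_measurable_times borel_measurable_indicator)
    finally show ?thesis by (simp add: box0)
  qed
  \<comment> \<open>The complement case below needs the integral over the whole space, obtained by
    exhausting it with growing boxes.\<close>
  have UNIV0: "integral\<^sup>L lborel g' = 0"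
  proof -
    let ?B = "\<lambda>n::nat. box (- real n *\<^sub>R One) (real n *\<^sub>R One) :: 'a set"
    have "incseq ?B"
      by (fastforce simp: incseq_def mem_box)
    then have "(\<lambda>n. LINT x:?B n|lborel. g' x) \<longlonglongrightarrow> (LINT x:(\<Union>n. ?B n)|lborel. g' x)"
      using int by (intro set_integral_cont_up) (auto simp: set_integrable_def UN_box_eq_UNIV[simplified])
    then show ?thesis
      unfolding box0' using UN_box_eq_UNIV[where 'a='a]
      by (simp add: LIMSEQ_const_iff set_lebesgue_integral_def)
  qed
  have "(LINT x:A|lborel. g' x) = 0" if "A \<in> sets lborel" for A
  proof -
    have "Int_stable (range (\<lambda>(a, b). box a b :: 'a set))"
      by (force simp: Int_stable_def box_Int_box)
    moreover have "range (\<lambda>(a, b). box a b :: 'a set) \<subseteq> Pow UNIV"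
      by simp
    moreover have "A \<in> sigma_sets UNIV (range (\<lambda>(a, b). box a b))"
      using that by (simp add: borel_eq_box)
    ultimately show ?thesis
    proof (induction rule: sigma_sets_induct_disjoint)
      case (basic A)
      then show ?case using box0' by auto
    next
      case (compl A)
      then have [measurable]: "A \<in> sets borel"
        by (simp add: borel_eq_box)
      have "(LINT x:UNIV - A|lborel. g' x) = (LINT x|lborel. g' x - indicator A x *\<^sub>R g' x)"
        unfolding set_lebesgue_integral_def
        by (intro Bochner_Integration.integral_cong) (auto simp: indicator_def)
      also have "\<dots> = integral\<^sup>L lborel g' - (LINT x:A|lborel. g' x)"
        unfolding set_lebesgue_integral_def
        using int integrable_mult_indicator[OF _ int, of A]
        by (intro Bochner_Integration.integral_diff) auto
      finally show ?case using compl UNIV0 by simp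
    next
      case (union A)
      then have "A i \<in> sets borel" for i
        by (auto simp: borel_eq_box)
      then have "(LINT x:(\<Union>i. A i)|lborel. g' x) = (\<Sum>i. LINT x:A i|lborel. g' x)"
        using union int integrable_mult_indicator[OF _ int, of "\<Union>i. A i"]
        by (intro lebesgue_integral_countable_add) (auto simp: disjoint_family_on_def set_integrable_def)
      with union show ?case by simp
    qed (simp add: set_lebesgue_integral_def)
  qed
  then have "AE x in lborel. g' x = 0"
    using int by (intro sigma_finite_measure.density_zero[OF sigma_finite_lborel])
  then have "AE x in lebesgue. g' x = 0"
    by (rule AE_completion)
  with eq show ?thesis by eventually_elim simp
qed

section \<open>Pairing locally integrable functions with test functions\<close>

lemma integrable_lebesgue_on_supported:
  fixes f :: "'a::euclidean_space \<Rightarrow> real"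
  assumes "K \<subseteq> U" "K \<in> sets lebesgue" "U \<in> sets lebesgue"
    and "integrable (lebesgue_on K) f" "\<And>x. x \<notin> K \<Longrightarrow> f x = 0"
  shows "integrable (lebesgue_on U) f"
proof -
  have "indicator K x *\<^sub>R f x = indicator U x *\<^sub>R f x" for x
    using assms by (auto simp: indicator_def)
  moreover have "integrable lebesgue (\<lambda>x. indicator K x *\<^sub>R f x)"
    using assms by (simp add: integrable_restrict_space)
  ultimately show ?thesis
    using assms by (simp only: integrable_restrict_space sets.Int_space_eq2)
qed

text \<open>Local integrability suffices because the continuous factor is bounded on
  \<open>K\<close> and zero outside it. This makes both sides of the weak derivative identity
  genuine integrals, so that they may be added.\<close>

lemma integrable_L1_loc_mult:
  fixes f :: "'a::euclidean_space \<Rightarrow> real"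
  assumes "f \<in> L1_loc U" "open U" "compact K" "K \<subseteq> U"
    and "continuous_on UNIV \<psi>" "\<And>x. x \<notin> K \<Longrightarrow> \<psi> x = 0"
  shows "integrable (lebesgue_on U) (\<lambda>x. f x * \<psi> x)"
proof (rule integrable_lebesgue_on_supported)
  have meas: "\<psi> \<in> borel_measurable (lebesgue_on K)"
    using assms by (intro continuous_imp_measurable_on_sets_lebesgue)
      (auto intro: continuous_on_subset simp: borel_compact)
  obtain C where "\<And>x. x \<in> K \<Longrightarrow> \<bar>\<psi> x\<bar> \<le> C"
    using assms compact_continuous_image[of K \<psi>] continuous_on_subset[of UNIV \<psi> K]
      compact_imp_bounded[of "\<psi> ` K"]
    by (auto simp: bounded_iff)
  then have bd: "AE x in lebesgue_on K. \<bar>\<psi> x\<bar> \<le> C"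
    by (intro AE_I2) simp
  have int: "integrable (lebesgue_on K) f"
    using assms by (simp add: L1_loc_def)
  show "integrable (lebesgue_on K) (\<lambda>x. f x * \<psi> x)"
  proof (rule Bochner_Integration.integrable_bound)
    show "integrable (lebesgue_on K) (\<lambda>x. C * f x)"
      using int by simp
    show "(\<lambda>x. f x * \<psi> x) \<in> borel_measurable (lebesgue_on K)"
      using meas borel_measurable_integrable[OF int] by simp
    show "AE x in lebesgue_on K. norm (f x * \<psi> x) \<le> norm (C * f x)"
      using bd
      by eventually_elim
         (auto simp: abs_mult mult.commute intro!: mult_right_mono)
  qed
qed (use assms in \<open>auto simp: borel_compact\<close>)

text \<open>On a closed box inside \<open>U\<close>, dominated convergence along the bumps shows
  that \<open>g\<close> has zero integral over every open box contained in it, so \<open>g\<close>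
  vanishes there almost everywhere; countably many such closed boxes cover \<open>U\<close>.\<close>

lemma fundamental_lemma_variations:
  fixes g :: "'a::euclidean_space \<Rightarrow> real"
  assumes g: "g \<in> L1_loc U" and U: "open U"
    and ann: "\<And>\<phi>. test_function U \<phi> \<Longrightarrow> (LINT x|lebesgue_on U. g x * \<phi> x) = 0"
  shows "AE x in lebesgue_on U. g x = 0"
proof -
  have loc: "AE x in lebesgue. x \<in> cbox c d \<longrightarrow> g x = 0" if cd: "cbox c d \<subseteq> U" for c d
  proof -
    have int: "integrable lebesgue (\<lambda>x. indicator (cbox c d) x *\<^sub>R g x)"
      using g cd by (subst integrable_restrict_space[symmetric]) (auto simp: L1_loc_def)
    have box0: "(LINT x|lebesgue. indicator (box a b) x * (indicator (cbox c d) x * g x)) = 0"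
      if ab: "box a b \<subseteq> cbox c d" for a b
    proof -
      have [measurable]: "box_bump a b k \<in> borel_measurable lebesgue" for k
        using test_function_box_bump[OF ab, of UNIV k]
        by (intro measurable_completion)
           (auto simp: test_function_def intro: borel_measurable_continuous_onI dest!: spec[of _ 0])
      have "(\<lambda>k. LINT x|lebesgue. box_bump a b k x * (indicator (cbox c d) x * g x))
          \<longlonglongrightarrow> (LINT x|lebesgue. indicator (box a b) x * (indicator (cbox c d) x * g x))"
      proof (rule integral_dominated_convergence)
        show "integrable lebesgue (\<lambda>x. norm (indicator (cbox c d) x *\<^sub>R g x))"
          using int by (rule integrable_norm)
        show "AE x in lebesgue. norm (box_bump a b k x * (indicator (cbox c d) x * g x))
            \<le> norm (indicator (cbox c d) x *\<^sub>R g x)" for k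
          using box_bump_bounded[of a b k]
          by (auto simp: abs_mult intro!: mult_left_le_one_le)
      qed (use borel_measurable_integrable[OF int] in
          \<open>auto intro!: tendsto_intros box_bump_tendsto_indicator borel_measurable_times
            borel_measurable_indicator\<close>)
      moreover have "(LINT x|lebesgue. box_bump a b k x * (indicator (cbox c d) x * g x)) = 0" for k
      proof -
        \<comment> \<open>The bump already vanishes off \<open>box a b\<close>, so the cut-off to
          \<open>cbox c d\<close> may be exchanged for the one to \<open>U\<close>.\<close>
        have "box_bump a b k x * (indicator (cbox c d) x * g x) =
            indicator U x *\<^sub>R (g x * box_bump a b k x)" for x
          using ab cd box_bump_eq_0[of x a b k] by (auto simp: indicator_def)
        moreover have "(LINT x|lebesgue. indicator U x *\<^sub>R (g x * box_bump a b k x)) = 0"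
          using ann[OF test_function_box_bump[OF ab compact_cbox cd, of k]] U
          by (simp add: integral_restrict_space)
        ultimately show ?thesis by (simp only:)
      qed
      ultimately show ?thesis by (simp add: LIMSEQ_const_iff)
    qed
    \<comment> \<open>The extra cut-off to the open box reduces an arbitrary test box to its
      intersection with \<open>box c d\<close>, which is again a box and lies inside
      \<open>cbox c d\<close>.\<close>
    have "AE x in lebesgue. indicator (box c d) x * (indicator (cbox c d) x *\<^sub>R g x) = 0"
    proof (rule AE_eq_0_if_box_integrals_eq_0)
      show "integrable lebesgue (\<lambda>x. indicator (box c d) x * (indicator (cbox c d) x *\<^sub>R g x))"
        using integrable_mult_indicator[OF _ int, of "box c d"] by simp
      show "(LINT x|lebesgue. indicator (box a b) x *
          (indicator (box c d) x * (indicator (cbox c d) x *\<^sub>R g x))) = 0" for a b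
      proof -
        obtain a' b' where ab': "box a b \<inter> box c d = box a' b'"
          by (simp only: box_Int_box)
        then have "box a' b' \<subseteq> cbox c d"
          using box_subset_cbox by blast
        from box0[OF this] show ?thesis
          unfolding ab'[symmetric] by (simp add: indicator_inter_arith mult.assoc)
      qed
    qed
    moreover have "AE x in lebesgue. x \<notin> cbox c d - box c d"
      by (intro AE_not_in) (simp add: negligible_iff_null_sets[symmetric] negligible_frontier_interval)
    ultimately show ?thesis
      by eventually_elim (auto simp: indicator_def split: if_splits)
  qed
  obtain \<D> where \<D>: "countable \<D>" "\<D> \<subseteq> Pow U" "\<And>X. X \<in> \<D> \<Longrightarrow> \<exists>a b. X = cbox a b" "\<Union>\<D> = U"
    using open_countable_Union_open_cbox[OF U] by metis
  have "AE x in lebesgue. \<forall>X\<in>\<D>. x \<in> X \<longrightarrow> g x = 0"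
    using \<D> loc by (subst AE_ball_countable) (blast, metis PowD subsetD)
  then have "AE x in lebesgue. x \<in> U \<longrightarrow> g x = 0"
    by eventually_elim (use \<D>(4) in blast)
  then show ?thesis
    using U by (simp add: AE_restrict_space_iff)
qed

section \<open>Weak gradients\<close>

lemma L1_loc_bounded_linear:
  assumes "f \<in> L1_loc U" "bounded_linear h"
  shows "(\<lambda>x. h (f x)) \<in> L1_loc U"
proof -
  interpret bounded_linear h by fact
  have "h \<in> borel_measurable borel"
    by (intro borel_measurable_continuous_onI linear_continuous_on assms)
  then show ?thesis
    using assms by (auto simp: L1_loc_def intro: integrable_bounded_linear measurable_compose)
qed

lemma L1_loc_vec_nth: "f \<in> L1_loc U \<Longrightarrow> (\<lambda>x. f x $ i) \<in> L1_loc U"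
  by (rule L1_loc_bounded_linear[OF _ bounded_linear_vec_nth])

lemma L1_loc_lincomb:
  assumes "f \<in> L1_loc U" "g \<in> L1_loc U"
  shows "(\<lambda>x. a *\<^sub>R f x + b *\<^sub>R g x) \<in> L1_loc U"
  using assms by (auto simp: L1_loc_def)

lemma test_functionE:
  assumes "test_function U \<phi>"
  obtains K where "compact K" "K \<subseteq> U" "continuous_on UNIV \<phi>" "\<And>x. x \<notin> K \<Longrightarrow> \<phi> x = 0"
    "\<And>i. i \<in> Basis \<Longrightarrow> continuous_on UNIV (\<lambda>x. frechet_derivative \<phi> (at x) i)"
    "\<And>x i. x \<notin> K \<Longrightarrow> frechet_derivative \<phi> (at x) i = 0"
proof -
  obtain K where K: "compact K" "K \<subseteq> U" "\<And>x. x \<notin> K \<Longrightarrow> \<phi> x = 0"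
    using assms by (auto simp: test_function_def)
  have Ck: "Ck 0 \<phi>" "Ck 1 \<phi>"
    using assms by (auto simp: test_function_def simp del: Ck.simps)
  have "frechet_derivative \<phi> (at x) i = 0" if "x \<notin> K" for x i
  proof -
    have "(\<phi> has_derivative (\<lambda>h. 0)) (at x)"
      by (rule has_derivative_transform_within_open[OF has_derivative_const, of "- K"])
         (use K that in \<open>auto intro: compact_imp_closed\<close>)
    then show ?thesis
      by (simp flip: frechet_derivative_at)
  qed
  with K Ck show ?thesis
    by (intro that[of K]) auto
qed

text \<open>The defining identity is linear in the pair of function and gradient. The work lies in
  the integrability of all four products, which comes from the compact support of the test function
  and its derivative.\<close>

lemma has_weak_grad_lincomb:
  assumes U: "open U" and f: "has_weak_grad U f F" and g: "has_weak_grad U g G"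
  shows "has_weak_grad U (\<lambda>x. a *\<^sub>R f x + b *\<^sub>R g x) (\<lambda>x. a *\<^sub>R F x + b *\<^sub>R G x)"
  unfolding has_weak_grad_def
proof (intro conjI allI impI L1_loc_lincomb)
  fix \<phi> and \<alpha> :: 'b and i :: 'a
  assume \<phi>: "test_function U \<phi>"
  let ?D = "\<lambda>x. frechet_derivative \<phi> (at x) (axis i 1)"
  obtain K where K: "compact K" "K \<subseteq> U" "continuous_on UNIV \<phi>" "\<And>x. x \<notin> K \<Longrightarrow> \<phi> x = 0"
    "\<And>i. i \<in> Basis \<Longrightarrow> continuous_on UNIV (\<lambda>x. frechet_derivative \<phi> (at x) i)"
    "\<And>x i. x \<notin> K \<Longrightarrow> frechet_derivative \<phi> (at x) i = 0"
    using test_functionE[OF \<phi>] by metis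
  have "axis i (1::real) \<in> Basis"
    by (simp add: axis_in_Basis_iff)
  then have D: "continuous_on UNIV ?D" "\<And>x. x \<notin> K \<Longrightarrow> ?D x = 0"
    using K(5,6) by blast+
  have f\<phi>: "integrable (lebesgue_on U) (\<lambda>x. f x $ \<alpha> * ?D x)" if "has_weak_grad U f F" for f F
    using that by (intro integrable_L1_loc_mult[OF _ U K(1,2) D] L1_loc_vec_nth) (simp_all add: has_weak_grad_def)
  have F\<phi>: "integrable (lebesgue_on U) (\<lambda>x. F x $ \<alpha> $ i * \<phi> x)" if "has_weak_grad U f F" for f F
    using that by (intro integrable_L1_loc_mult[OF _ U K(1-4)] L1_loc_vec_nth) (simp_all add: has_weak_grad_def)
  note int = f\<phi>[OF f] f\<phi>[OF g] F\<phi>[OF f] F\<phi>[OF g]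
  have eq: "(LINT x|lebesgue_on U. f x $ \<alpha> * ?D x) = - (LINT x|lebesgue_on U. F x $ \<alpha> $ i * \<phi> x)"
      "(LINT x|lebesgue_on U. g x $ \<alpha> * ?D x) = - (LINT x|lebesgue_on U. G x $ \<alpha> $ i * \<phi> x)"
    using f g \<phi> by (auto simp: has_weak_grad_def)
  have "(LINT x|lebesgue_on U. (a *\<^sub>R f x + b *\<^sub>R g x) $ \<alpha> * ?D x) =
      (LINT x|lebesgue_on U. a * (f x $ \<alpha> * ?D x) + b * (g x $ \<alpha> * ?D x))"
    by (simp add: algebra_simps)
  also have "\<dots> = - (LINT x|lebesgue_on U. a * (F x $ \<alpha> $ i * \<phi> x) + b * (G x $ \<alpha> $ i * \<phi> x))"
    using int eq by simp
  also have "\<dots> = - (LINT x|lebesgue_on U. (a *\<^sub>R F x + b *\<^sub>R G x) $ \<alpha> $ i * \<phi> x)"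
    by (simp add: algebra_simps)
  finally show "(LINT x|lebesgue_on U. (a *\<^sub>R f x + b *\<^sub>R g x) $ \<alpha> * ?D x) =
      - (LINT x|lebesgue_on U. (a *\<^sub>R F x + b *\<^sub>R G x) $ \<alpha> $ i * \<phi> x)" .
qed (use f g in \<open>auto simp: has_weak_grad_def\<close>)

text \<open>The difference of two weak gradients is a weak gradient of the zero function, so each of
  its entries is annihilated by all test functions.\<close>

lemma has_weak_grad_unique:
  assumes U: "open U" and F: "has_weak_grad U f F" and G: "has_weak_grad U f G"
  shows "AE x in lebesgue_on U. F x = G x"
proof -
  have D: "has_weak_grad U (\<lambda>x. 0) (\<lambda>x. F x - G x)"
    using has_weak_grad_lincomb[OF U F G, of 1 "-1"] by simp
  have "AE x in lebesgue_on U. F x $ \<alpha> $ i - G x $ \<alpha> $ i = 0" for \<alpha> i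
  proof (rule fundamental_lemma_variations[OF _ U])
    have "(\<lambda>x. (F x - G x) $ \<alpha> $ i) \<in> L1_loc U"
      using D by (intro L1_loc_vec_nth) (simp add: has_weak_grad_def)
    then show "(\<lambda>x. F x $ \<alpha> $ i - G x $ \<alpha> $ i) \<in> L1_loc U"
      by simp
  qed (use D in \<open>simp add: has_weak_grad_def\<close>)
  then have "AE x in lebesgue_on U. \<forall>\<alpha> i. F x $ \<alpha> $ i - G x $ \<alpha> $ i = 0"
    by (simp add: AE_all_countable)
  then show ?thesis
    by eventually_elim (simp add: vec_eq_iff)
qed

lemma has_weak_grad_weak_grad: "has_weak_grad U f G \<Longrightarrow> has_weak_grad U f (weak_grad U f)"
  unfolding weak_grad_def by (rule someI[of "has_weak_grad U f"])

lemma H1_has_weak_grad: "f \<in> H1 U \<Longrightarrow> has_weak_grad U f (weak_grad U f)"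
  by (auto simp: H1_def intro: has_weak_grad_weak_grad)

lemma weak_grad_borel_measurable:
  "f \<in> H1 U \<Longrightarrow> weak_grad U f \<in> borel_measurable (lebesgue_on U)"
  using H1_has_weak_grad[of f U] by (auto simp: has_weak_grad_def L1_loc_def)

text \<open>\<open>weak_grad\<close> makes an independent choice for each function, so linearity can
  only be recovered almost everywhere, through uniqueness.\<close>

lemma weak_grad_lincomb:
  assumes "open U" "f \<in> H1 U" "g \<in> H1 U"
  shows "AE x in lebesgue_on U.
    weak_grad U (\<lambda>x. a *\<^sub>R f x + b *\<^sub>R g x) x = a *\<^sub>R weak_grad U f x + b *\<^sub>R weak_grad U g x"
proof -
  note grad = has_weak_grad_lincomb[OF assms(1) assms(2,3)[THEN H1_has_weak_grad], of a b]
  show ?thesis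
    by (rule has_weak_grad_unique[OF assms(1) has_weak_grad_weak_grad[OF grad] grad])
qed

section \<open>Square-integrable functions\<close>

lemma integrable_inner_L2:
  assumes "f \<in> L2 U" "g \<in> L2 U"
  shows "integrable (lebesgue_on U) (\<lambda>x. f x \<bullet> g x)"
proof (rule Bochner_Integration.integrable_bound)
  show "integrable (lebesgue_on U) (\<lambda>x. (norm (f x))\<^sup>2 + (norm (g x))\<^sup>2)"
    using assms by (auto simp: L2_def)
  show "(\<lambda>x. f x \<bullet> g x) \<in> borel_measurable (lebesgue_on U)"
    using assms by (auto simp: L2_def)
  have "\<bar>f x \<bullet> g x\<bar> \<le> (norm (f x))\<^sup>2 + (norm (g x))\<^sup>2" for x
    using Cauchy_Schwarz_ineq2[of "f x" "g x"] sum_squares_bound[of "norm (f x)" "norm (g x)"]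
      zero_le_power2[of "norm (f x)"] zero_le_power2[of "norm (g x)"]
    by linarith
  then show "AE x in lebesgue_on U. norm (f x \<bullet> g x) \<le> norm ((norm (f x))\<^sup>2 + (norm (g x))\<^sup>2)"
    by simp
qed

lemma L2_norm_on_sq: "(L2_norm_on U f)\<^sup>2 = L2_inner U f f"
  by (simp add: L2_norm_on_def L2_inner_def)

text \<open>Pointwise, \<open>2 * ((f - g) \<bullet> f)\<close> exceeds the difference of squares by
  the squared norm of \<open>f - g\<close>. This discarded term is the numerical dissipation of the
  implicit Euler scheme.\<close>

lemma L2_inner_difference_quotient:
  assumes "f \<in> L2 U" "g \<in> L2 U" "\<tau> > 0"
  shows "((L2_norm_on U f)\<^sup>2 - (L2_norm_on U g)\<^sup>2) / (2 * \<tau>) \<le>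
    L2_inner U (\<lambda>x. (f x - g x) /\<^sub>R \<tau>) f"
proof -
  note int = integrable_inner_L2[of _ U, OF assms(1,1)] integrable_inner_L2[of _ U, OF assms(2,2)]
    integrable_inner_L2[of _ U, OF assms(2,1)]
  have "((L2_norm_on U f)\<^sup>2 - (L2_norm_on U g)\<^sup>2) / (2 * \<tau>) =
      (LINT x|lebesgue_on U. (f x \<bullet> f x - g x \<bullet> g x) / (2 * \<tau>))"
    using int by (simp add: L2_norm_on_sq L2_inner_def)
  also have "\<dots> \<le> (LINT x|lebesgue_on U. (f x \<bullet> f x - g x \<bullet> f x) / \<tau>)"
  proof (rule integral_mono)
    fix x
    have "0 \<le> (f x - g x) \<bullet> (f x - g x)" by simp
    then have "f x \<bullet> f x - g x \<bullet> g x \<le> 2 * (f x \<bullet> f x - g x \<bullet> f x)"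
      by (simp add: inner_diff inner_commute)
    then have "(f x \<bullet> f x - g x \<bullet> g x) / (2 * \<tau>) \<le> 2 * (f x \<bullet> f x - g x \<bullet> f x) / (2 * \<tau>)"
      using \<open>\<tau> > 0\<close> by (intro divide_right_mono) auto
    then show "(f x \<bullet> f x - g x \<bullet> g x) / (2 * \<tau>) \<le> (f x \<bullet> f x - g x \<bullet> f x) / \<tau>"
      by (simp only: mult_divide_mult_cancel_left[of 2] zero_neq_numeral not_False_eq_True)
  qed (use int in auto)
  also have "\<dots> = L2_inner U (\<lambda>x. (f x - g x) /\<^sub>R \<tau>) f"
    by (simp add: L2_inner_def inner_diff divide_inverse mult.commute)
  finally show ?thesis .
qed

section \<open>The Piola-Kirchhoff stress and the elastic energy\<close>

lemma DERIV_along_line: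
  assumes "W differentiable (at F)"
  shows "DERIV (\<lambda>t. W (F + t *\<^sub>R H)) 0 :> frechet_derivative W (at F) H"
proof -
  let ?D = "frechet_derivative W (at F)"
  have D: "(W has_derivative ?D) (at F)"
    using assms by (simp flip: frechet_derivative_works)
  have "((\<lambda>t. W (F + t *\<^sub>R H)) has_derivative (\<lambda>t. ?D (t *\<^sub>R H))) (at 0)"
  proof (rule has_derivative_compose[where f = "\<lambda>t. F + t *\<^sub>R H" and f' = "\<lambda>t. t *\<^sub>R H" and g' = ?D])
    show "((\<lambda>t. F + t *\<^sub>R H) has_derivative (\<lambda>t. t *\<^sub>R H)) (at 0)"
      by (auto intro!: derivative_eq_intros)
  qed (use D in simp)
  then show ?thesis
    using has_derivative_bounded_linear[OF D]
    by (simp add: has_field_derivative_def linear_simps mult.commute[of _ "?D H"])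
qed

text \<open>\<open>piola\<close> only collects partial derivatives; differentiability of
  \<open>W\<close> lets them represent the full derivative, by expanding \<open>H\<close> in matrix
  units.\<close>

lemma piola_inner:
  fixes W :: "real^'m^'d \<Rightarrow> real"
  assumes "W differentiable (at F)"
  shows "piola W F \<bullet> H = frechet_derivative W (at F) H"
proof -
  let ?D = "frechet_derivative W (at F)"
  have D: "(W has_derivative ?D) (at F)"
    using assms by (simp flip: frechet_derivative_works)
  then interpret bounded_linear ?D
    by (rule has_derivative_bounded_linear)
  have "piola W F $ \<alpha> $ i = ?D (axis \<alpha> (axis i 1))" for \<alpha> i
    using DERIV_along_line[OF assms] by (simp add: piola_def DERIV_imp_deriv)
  then have "piola W F \<bullet> H = (\<Sum>\<alpha>\<in>UNIV. \<Sum>i\<in>UNIV. ?D (axis \<alpha> (axis i 1)) * H $ \<alpha> $ i)"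
    by (simp add: inner_vec_def)
  also have "\<dots> = ?D (\<Sum>\<alpha>\<in>UNIV. \<Sum>i\<in>UNIV. H $ \<alpha> $ i *\<^sub>R axis \<alpha> (axis i 1))"
    by (simp add: sum scaleR mult.commute)
  also have "(\<Sum>\<alpha>\<in>UNIV. \<Sum>i\<in>UNIV. H $ \<alpha> $ i *\<^sub>R axis \<alpha> (axis i 1)) = H"
  proof -
    have "(r *\<^sub>R axis \<alpha> (axis i 1)) $ \<beta> $ j = (if i = j then if \<alpha> = \<beta> then r else 0 else 0)"
      for r :: real and \<alpha> \<beta> :: 'd and i j :: 'm
      by (simp add: axis_def)
    then show ?thesis
      by (simp add: vec_eq_iff del: vector_scaleR_component)
  qed
  finally show ?thesis .
qed

text \<open>By convexity every difference quotient from \<open>F\<close> towards \<open>G\<close>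
  with step in (0,1) is at most \<open>W G - W F\<close>; the bound survives the limit of the step
  to zero.\<close>

lemma piola_subgradient:
  assumes "convex_on UNIV W" "W differentiable (at F)"
  shows "piola W F \<bullet> (G - F) \<le> W G - W F"
proof -
  let ?D = "frechet_derivative W (at F)"
  have "((\<lambda>t. (W (F + t *\<^sub>R (G - F)) - W F) / t) \<longlongrightarrow> ?D (G - F)) (at_right 0)"
    using DERIV_along_line[OF assms(2)] by (auto simp: DERIV_def intro: tendsto_within_subset)
  moreover have "\<forall>\<^sub>F t in at_right 0. (W (F + t *\<^sub>R (G - F)) - W F) / t \<le> W G - W F"
  proof -
    have "(W (F + t *\<^sub>R (G - F)) - W F) / t \<le> W G - W F" if "0 < t" "t < 1" for t
    proof -
      have "W ((1 - t) *\<^sub>R F + t *\<^sub>R G) \<le> (1 - t) * W F + t * W G"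
        using assms(1) that by (intro convex_onD) auto
      moreover have "(1 - t) *\<^sub>R F + t *\<^sub>R G = F + t *\<^sub>R (G - F)"
        by (simp add: algebra_simps)
      ultimately show ?thesis
        using that by (simp add: field_simps)
    qed
    then show ?thesis
      by (auto simp: eventually_at_right_field intro: exI[of _ 1])
  qed
  ultimately have "?D (G - F) \<le> W G - W F"
    by (rule tendsto_upperbound) simp
  then show ?thesis
    using assms by (simp add: piola_inner)
qed

lemma Ck_1_differentiable: "Ck 1 W \<Longrightarrow> W differentiable (at F)"
  by simp

section \<open>Integrability and increments of the energy density\<close>

lemma finite_measure_lebesgue_on_bounded:
  assumes "bounded (B :: 'a::euclidean_space set)" "open B"
  shows "finite_measure (lebesgue_on B)"
proof
  have "B \<in> lmeasurable"
    using assms by (intro lmeasurable_open)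
  then show "emeasure (lebesgue_on B) (space (lebesgue_on B)) \<noteq> \<infinity>"
    by (auto simp: emeasure_restrict_space fmeasurable_def)
qed

lemma energy_density_measurable:
  assumes "Ck 1 W" "f \<in> H1 U"
  shows "(\<lambda>x. W (weak_grad U f x)) \<in> borel_measurable (lebesgue_on U)"
proof -
  have "W \<in> borel_measurable borel"
    using Ck_Suc_imp_Ck[of 0 W] assms(1) by (intro borel_measurable_continuous_onI) simp
  then show ?thesis
    using weak_grad_borel_measurable[OF assms(2)] by (rule measurable_compose[rotated])
qed

text \<open>The chosen weak gradient agrees almost everywhere with an essentially bounded one, and
  the continuous \<open>W\<close> is bounded on the corresponding closed ball.\<close>

lemma energy_integrable_W1inf:
  fixes f :: "real^'m \<Rightarrow> real^'d"
  assumes "open U" "bounded U" "Ck 1 W" "f \<in> H1 U" "f \<in> W1inf U"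
  shows "integrable (lebesgue_on U) (\<lambda>x. W (weak_grad U f x))"
proof -
  interpret finite_measure "lebesgue_on U"
    using assms by (intro finite_measure_lebesgue_on_bounded)
  obtain G C where G: "has_weak_grad U f G" "AE x in lebesgue_on U. norm (G x) \<le> C"
    using assms by (auto simp: W1inf_def Linf_def)
  have "continuous_on (cball 0 C) W"
    using Ck_Suc_imp_Ck[of 0 W] assms(3) by (auto intro: continuous_on_subset)
  then have "bounded (W ` cball 0 C)"
    by (intro compact_imp_bounded compact_continuous_image) auto
  then obtain M where "\<forall>F\<in>cball 0 C. \<bar>W F\<bar> \<le> M"
    by (auto simp: bounded_iff)
  then have M: "\<bar>W F\<bar> \<le> M" if "norm F \<le> C" for F
    using that by simp
  have "AE x in lebesgue_on U. norm (W (weak_grad U f x)) \<le> M"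
    using G(2) has_weak_grad_unique[OF assms(1) H1_has_weak_grad[OF assms(4)] G(1)]
    by eventually_elim (simp add: M)
  then show ?thesis
    using assms by (intro integrable_const_bound energy_density_measurable)
qed

lemma energy_integrable_stress:
  fixes f :: "real^'m \<Rightarrow> real^'d"
  assumes "open U" "bounded U" "Ck 1 W" "convex_on UNIV W" "\<And>F. 0 \<le> W F" "f \<in> H1 U"
    and stress: "integrable (lebesgue_on U) (\<lambda>x. piola W (weak_grad U f x) \<bullet> weak_grad U f x)"
  shows "integrable (lebesgue_on U) (\<lambda>x. W (weak_grad U f x))"
proof (rule Bochner_Integration.integrable_bound)
  interpret finite_measure "lebesgue_on U"
    using assms by (intro finite_measure_lebesgue_on_bounded)
  show "integrable (lebesgue_on U) (\<lambda>x. W 0 + piola W (weak_grad U f x) \<bullet> weak_grad U f x)"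
    using stress by simp
  \<comment> \<open>The subgradient inequality towards the zero matrix bounds \<open>W F\<close>
    from above; nonnegativity of \<open>W\<close> turns this into a bound in absolute value.\<close>
  have "norm (W F) \<le> norm (W 0 + piola W F \<bullet> F)" for F
    using piola_subgradient[OF assms(4) Ck_1_differentiable[OF assms(3)], of F 0] assms(5)[of F]
    by simp
  then show "AE x in lebesgue_on U. norm (W (weak_grad U f x))
      \<le> norm (W 0 + piola W (weak_grad U f x) \<bullet> weak_grad U f x)"
    by simp
qed (use assms in \<open>intro energy_density_measurable\<close>)

text \<open>The subgradient is taken at the new configuration \<open>X\<close>, where the scheme
  evaluates the stress; this is why the increment is bounded from above.\<close>

lemma elastic_energy_increment:
  fixes X Y :: "real^'m \<Rightarrow> real^'d"
  assumes U: "open U" and W: "Ck 1 W" "convex_on UNIV W" and XY: "X \<in> H1 U" "Y \<in> H1 U"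
    and int: "integrable (lebesgue_on U) (\<lambda>x. W (weak_grad U X x))"
      "integrable (lebesgue_on U) (\<lambda>x. W (weak_grad U Y x))"
      "integrable (lebesgue_on U) (\<lambda>x. piola W (weak_grad U X x) \<bullet> weak_grad U X x)"
      "integrable (lebesgue_on U) (\<lambda>x. piola W (weak_grad U X x) \<bullet> weak_grad U Y x)"
      "integrable (lebesgue_on U)
        (\<lambda>x. piola W (weak_grad U X x) \<bullet> weak_grad U (\<lambda>x. (X x - Y x) /\<^sub>R \<tau>) x)"
    and \<tau>: "\<tau> > 0"
  shows "(elastic_energy U W X - elastic_energy U W Y) / \<tau> \<le>
    L2_inner U (\<lambda>x. piola W (weak_grad U X x)) (weak_grad U (\<lambda>x. (X x - Y x) /\<^sub>R \<tau>))"
proof -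
  let ?P = "\<lambda>x. piola W (weak_grad U X x)"
  let ?I = "\<lambda>x. (?P x \<bullet> weak_grad U X x - ?P x \<bullet> weak_grad U Y x) / \<tau>"
  have quot: "AE x in lebesgue_on U.
      ?P x \<bullet> weak_grad U (\<lambda>x. (X x - Y x) /\<^sub>R \<tau>) x = ?I x"
  proof -
    have "(\<lambda>x. (X x - Y x) /\<^sub>R \<tau>) = (\<lambda>x. inverse \<tau> *\<^sub>R X x + (- inverse \<tau>) *\<^sub>R Y x)"
      by (simp add: scaleR_diff_right)
    then have "AE x in lebesgue_on U. weak_grad U (\<lambda>x. (X x - Y x) /\<^sub>R \<tau>) x =
        inverse \<tau> *\<^sub>R weak_grad U X x + (- inverse \<tau>) *\<^sub>R weak_grad U Y x"
      using weak_grad_lincomb[OF U XY] by (simp only:)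
    then show ?thesis
      by (rule eventually_mono)
         (simp only: inner_add_right inner_scaleR_right, simp add: divide_inverse algebra_simps)
  qed
  have "(elastic_energy U W X - elastic_energy U W Y) / \<tau> =
      (LINT x|lebesgue_on U. (W (weak_grad U X x) - W (weak_grad U Y x)) / \<tau>)"
    using int by (simp add: elastic_energy_def)
  also have "\<dots> \<le> (LINT x|lebesgue_on U. ?I x)"
  proof (rule integral_mono)
    show "(W (weak_grad U X x) - W (weak_grad U Y x)) / \<tau> \<le> ?I x" for x
      using piola_subgradient[OF W(2) Ck_1_differentiable[OF W(1)], of "weak_grad U X x" "weak_grad U Y x"] \<tau>
      by (intro divide_right_mono) (auto simp: inner_diff_right)
  qed (use int in auto)
  \<comment> \<open>The stress itself is not known to be measurable; the last of the integrability
    hypotheses supplies measurability of the integrand on the right.\<close>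
  also have "(LINT x|lebesgue_on U. ?I x) = L2_inner U ?P (weak_grad U (\<lambda>x. (X x - Y x) /\<^sub>R \<tau>))"
    unfolding L2_inner_def using int quot by (intro integral_cong_AE) (auto elim: eventually_mono)
  finally show ?thesis .
qed

section \<open>The energy estimate\<close>

text \<open>The skew-symmetrized convection cancels for any transporting field, so a velocity that
  is only discretely divergence free does no harm.\<close>

lemma b_form_skew: "b_form \<rho> U u v v = 0"
  by (simp add: b_form_def)

lemma lin_subspace_difference_quotient:
  assumes "lin_subspace V" "f \<in> V" "g \<in> V"
  shows "(\<lambda>x. (f x - g x) /\<^sub>R \<tau>) \<in> V"
proof -
  have "(\<lambda>x. inverse \<tau> *\<^sub>R f x + (- inverse \<tau>) *\<^sub>R g x) \<in> V"
    using assms unfolding lin_subspace_def by blast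
  then show ?thesis
    by (simp add: scaleR_diff_right)
qed

theorem proposition4:
  fixes \<Omega> :: "(real^'d) set" and B :: "(real^'m) set"
    and \<rho>f \<nu> \<delta>\<rho> T \<Delta>t \<sigma> \<sigma>' :: real and N :: nat
    and W :: "real^'m^'d \<Rightarrow> real"
    and \<Lambda> \<Lambda>h :: "(real^'m \<Rightarrow> real^'d) multiplier set"
    and M1 M2 Sh :: "(real^'m \<Rightarrow> real^'d) set"
    and c1 c2 :: "(real^'m \<Rightarrow> real^'d) multiplier \<Rightarrow> (real^'m \<Rightarrow> real^'d) \<Rightarrow> real"
    and \<T> :: "(real^'d) set set" and \<T>' :: "(real^'m) set set"
    and Vh :: "(real^'d \<Rightarrow> real^'d) set" and Qh :: "(real^'d \<Rightarrow> real) set"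
    and u0h :: "real^'d \<Rightarrow> real^'d" and X0 :: "real^'m \<Rightarrow> real^'d"
    and init_h :: "(real^'m \<Rightarrow> real^'d) \<Rightarrow> (real^'m \<Rightarrow> real^'d)"
    and u :: "int \<Rightarrow> real^'d \<Rightarrow> real^'d" and p :: "int \<Rightarrow> real^'d \<Rightarrow> real"
    and X :: "int \<Rightarrow> real^'m \<Rightarrow> real^'d" and mult :: "int \<Rightarrow> (real^'m \<Rightarrow> real^'d) multiplier"
  assumes dims: "CARD('d) \<in> {2, 3}" "CARD('m) = CARD('d) \<or> CARD('m) + 1 = CARD('d)"
    and Omega: "bounded_domain \<Omega>" "lipschitz_boundary \<Omega>"
    and B: "bounded_domain B"
    and constants: "\<rho>f > 0" "\<nu> > 0" "\<delta>\<rho> \<ge> 0" "T > 0" "N > 0" "\<Delta>t = T / real N"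
    and W: "\<And>F. W F \<ge> 0" "Ck 1 W" "convex_on UNIV W"
    and coupling: "coupling_choice B \<Lambda> M1 M2 c1 c2" "coupling_separates B \<Lambda> M1 M2 c1 c2"
    and meshes: "regular_mesh \<sigma> \<Omega> \<T>" "regular_mesh \<sigma>' B \<T>'"
    and Vh: "fe_space \<T> Vh" "Vh \<subseteq> H10 \<Omega>" "\<And>v. v \<in> Vh \<Longrightarrow> continuous_on \<Omega> v"
    and Qh: "fe_space \<T> Qh" "Qh \<subseteq> L2_zero_mean \<Omega>"
    and stokes: "discrete_kernel_elliptic \<nu> \<Omega> Vh Qh" "discrete_inf_sup \<Omega> Vh Qh"
    and Sh: "fe_space \<T>' Sh" "Sh \<subseteq> H1 B" "Sh \<subseteq> M2" "\<And>Y. Y \<in> Sh \<Longrightarrow> continuous_on B Y"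
    and Lambda_h: "multiplier_subspace \<Lambda>h \<Lambda>"
    and initial: "u0h \<in> Vh" "u 0 = u0h" "X0 \<in> W1inf B" "X 0 = init_h X0"
      "X 0 \<in> Sh \<inter> W1inf B" "X (-1) \<in> Sh"
    and unknowns: "\<And>n. n \<in> {0..int N} \<Longrightarrow> u n \<in> Vh" "\<And>n. n \<in> {0..int N} \<Longrightarrow> X n \<in> Sh"
      "\<And>n. n \<in> {1..int N} \<Longrightarrow> p n \<in> Qh" "\<And>n. n \<in> {1..int N} \<Longrightarrow> mult n \<in> \<Lambda>h"
    and composition: "\<And>n. n \<in> {0..<int N} \<Longrightarrow> X n ` B \<subseteq> \<Omega>"
      "\<And>n v. n \<in> {0..<int N} \<Longrightarrow> v \<in> Vh \<Longrightarrow> v \<circ> X n \<in> M1"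
    and stress_integrable: "\<And>n Y. n \<in> {0..<int N} \<Longrightarrow> Y \<in> Sh \<Longrightarrow>
      integrable (lebesgue_on B) (\<lambda>s. piola W (weak_grad B (X (n + 1)) s) \<bullet> weak_grad B Y s)"
    and momentum: "\<And>n v. n \<in> {0..<int N} \<Longrightarrow> v \<in> Vh \<Longrightarrow>
      \<rho>f * L2_inner \<Omega> (\<lambda>x. (u (n + 1) x - u n x) /\<^sub>R \<Delta>t) v
        + b_form \<rho>f \<Omega> (u n) (u (n + 1)) v + a_form \<nu> \<Omega> (u (n + 1)) v
        - L2_inner \<Omega> (weak_div \<Omega> v) (p (n + 1)) + c1 (mult (n + 1)) (v \<circ> X n) = 0"
    and incompressibility: "\<And>n q. n \<in> {0..<int N} \<Longrightarrow> q \<in> Qh \<Longrightarrow>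
      L2_inner \<Omega> (weak_div \<Omega> (u (n + 1))) q = 0"
    and solid: "\<And>n Y. n \<in> {0..<int N} \<Longrightarrow> Y \<in> Sh \<Longrightarrow>
      \<delta>\<rho> * L2_inner B (\<lambda>s. (X (n + 1) s - 2 *\<^sub>R X n s + X (n - 1) s) /\<^sub>R \<Delta>t\<^sup>2) Y
        + L2_inner B (\<lambda>s. piola W (weak_grad B (X (n + 1)) s)) (weak_grad B Y)
        - c2 (mult (n + 1)) Y = 0"
    and constraint: "\<And>n \<mu>. n \<in> {0..<int N} \<Longrightarrow> \<mu> \<in> \<Lambda>h \<Longrightarrow>
      c1 \<mu> (u (n + 1) \<circ> X n) - c2 \<mu> (\<lambda>s. (X (n + 1) s - X n s) /\<^sub>R \<Delta>t) = 0"
  shows "\<forall>n\<in>{0..<int N}.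
    \<rho>f / (2 * \<Delta>t) * ((L2_norm_on \<Omega> (u (n + 1)))\<^sup>2 - (L2_norm_on \<Omega> (u n))\<^sup>2)
      + \<nu> * (L2_norm_on \<Omega> (sym_grad \<Omega> (u (n + 1))))\<^sup>2
      + \<delta>\<rho> / (2 * \<Delta>t) *
          ((L2_norm_on B (\<lambda>s. (X (n + 1) s - X n s) /\<^sub>R \<Delta>t))\<^sup>2
           - (L2_norm_on B (\<lambda>s. (X n s - X (n - 1) s) /\<^sub>R \<Delta>t))\<^sup>2)
      + (elastic_energy B W (X (n + 1)) - elastic_energy B W (X n)) / \<Delta>t
    \<le> 0"
proof
  fix n assume n: "n \<in> {0..<int N}"
  then have n': "n \<in> {0..int N}" "n + 1 \<in> {0..int N}" "n + 1 \<in> {1..int N}"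
    by auto
  have dt: "\<Delta>t > 0"
    using constants by simp
  have Bopen: "open B" "bounded B"
    using B by (auto simp: bounded_domain_def)
  have Sh_lin: "lin_subspace Sh"
    using Sh(1) by (simp add: fe_space_def)
  have L2: "v \<in> L2 \<Omega>" if "v \<in> Vh" for v
    using that Vh(2) by (auto simp: H10_def H1_def)
  \<comment> \<open>The range starts at -1 because the old structure velocity in the first time step
    involves the prescribed \<open>X (-1)\<close>.\<close>
  have X_Sh: "X k \<in> Sh" if "k \<in> {- 1..int N}" for k
  proof (cases "k = - 1")
    case False
    then show ?thesis using that by (intro unknowns(2)) auto
  qed (use initial(6) in simp)
  have X_H1: "X k \<in> H1 B" if "k \<in> {- 1..int N}" for k
    using X_Sh[OF that] Sh(2) by blast
  let ?D = "\<lambda>k s. (X (k + 1) s - X k s) /\<^sub>R \<Delta>t"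
  have D_Sh: "?D k \<in> Sh" if "k \<in> {- 1..<int N}" for k
    using that by (intro lin_subspace_difference_quotient[OF Sh_lin] X_Sh) auto
  have D_L2: "?D k \<in> L2 B" if "k \<in> {- 1..<int N}" for k
    using D_Sh[OF that] Sh(2) by (auto simp: H1_def)
  have energy: "integrable (lebesgue_on B) (\<lambda>s. W (weak_grad B (X k) s))" if k: "k \<in> {0..int N}" for k
  \<comment> \<open>The stress at time k belongs to the step starting at k - 1, so the initial
    position has no stress bound and relies on its essentially bounded gradient instead.\<close>
  proof (cases "k = 0")
    case True
    then show ?thesis
      using Bopen W initial(5) X_H1[of 0] by (intro energy_integrable_W1inf) auto
  next
    case False
    then have "integrable (lebesgue_on B) (\<lambda>s. piola W (weak_grad B (X k) s) \<bullet> weak_grad B (X k) s)"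
      using stress_integrable[of "k - 1" "X k"] X_Sh[of k] k by simp
    then show ?thesis
      using k by (intro energy_integrable_stress[OF Bopen W(2,3,1) X_H1]) auto
  qed
  let ?u = "u (n + 1)" and ?l = "mult (n + 1)"
  have fluid: "\<rho>f * L2_inner \<Omega> (\<lambda>x. (?u x - u n x) /\<^sub>R \<Delta>t) ?u + a_form \<nu> \<Omega> ?u ?u
      + c1 ?l (?u \<circ> X n) = 0"
    using momentum[OF n unknowns(1)[OF n'(2)]] incompressibility[OF n unknowns(3)[OF n'(3)]]
    by (simp add: b_form_skew)
  \<comment> \<open>The multiplier of the step is itself an admissible test function in the
    constraint, which converts the fluid coupling term into the structural one.\<close>
  have "c1 ?l (?u \<circ> X n) = c2 ?l (?D n)"
    using constraint[OF n unknowns(4)[OF n'(3)]] by simp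
  moreover have "\<delta>\<rho> * L2_inner B (\<lambda>s. (?D n s - ?D (n - 1) s) /\<^sub>R \<Delta>t) (?D n)
      + L2_inner B (\<lambda>s. piola W (weak_grad B (X (n + 1)) s)) (weak_grad B (?D n)) = c2 ?l (?D n)"
  proof -
    \<comment> \<open>The second difference is the difference quotient of the discrete velocities,
      so the inertia has the same form as in the fluid equation.\<close>
    have "(\<lambda>s. (X (n + 1) s - 2 *\<^sub>R X n s + X (n - 1) s) /\<^sub>R \<Delta>t\<^sup>2) =
        (\<lambda>s. (?D n s - ?D (n - 1) s) /\<^sub>R \<Delta>t)"
      by (simp add: fun_eq_iff power2_eq_square scaleR_2 algebra_simps)
    then show ?thesis
      using solid[OF n D_Sh[of n]] n by simp
  qed
  ultimately have balance: "\<rho>f * L2_inner \<Omega> (\<lambda>x. (?u x - u n x) /\<^sub>R \<Delta>t) ?u + a_form \<nu> \<Omega> ?u ?u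
      + \<delta>\<rho> * L2_inner B (\<lambda>s. (?D n s - ?D (n - 1) s) /\<^sub>R \<Delta>t) (?D n)
      + L2_inner B (\<lambda>s. piola W (weak_grad B (X (n + 1)) s)) (weak_grad B (?D n)) = 0"
    using fluid by simp
  have "\<rho>f * (((L2_norm_on \<Omega> ?u)\<^sup>2 - (L2_norm_on \<Omega> (u n))\<^sup>2) / (2 * \<Delta>t))
      \<le> \<rho>f * L2_inner \<Omega> (\<lambda>x. (?u x - u n x) /\<^sub>R \<Delta>t) ?u"
    using constants dt n' by (intro mult_left_mono L2_inner_difference_quotient L2 unknowns) auto
  moreover have "\<delta>\<rho> * (((L2_norm_on B (?D n))\<^sup>2 - (L2_norm_on B (?D (n - 1)))\<^sup>2) / (2 * \<Delta>t))
      \<le> \<delta>\<rho> * L2_inner B (\<lambda>s. (?D n s - ?D (n - 1) s) /\<^sub>R \<Delta>t) (?D n)"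
    using constants(3) dt n D_L2[of n] D_L2[of "n - 1"]
    by (intro mult_left_mono L2_inner_difference_quotient) auto
  moreover have "(elastic_energy B W (X (n + 1)) - elastic_energy B W (X n)) / \<Delta>t
      \<le> L2_inner B (\<lambda>s. piola W (weak_grad B (X (n + 1)) s)) (weak_grad B (?D n))"
    \<comment> \<open>The stress at time n + 1 is paired in turn with the gradients of the new
      position, the old position and the discrete velocity.\<close>
    using n by (intro elastic_energy_increment[OF Bopen(1) W(2,3) X_H1 X_H1 energy energy
          stress_integrable[OF n X_Sh] stress_integrable[OF n X_Sh] stress_integrable[OF n D_Sh] dt]) auto
  moreover have "a_form \<nu> \<Omega> ?u ?u = \<nu> * (L2_norm_on \<Omega> (sym_grad \<Omega> ?u))\<^sup>2"
    by (simp add: a_form_def L2_norm_on_sq)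
  ultimately show "\<rho>f / (2 * \<Delta>t) * ((L2_norm_on \<Omega> ?u)\<^sup>2 - (L2_norm_on \<Omega> (u n))\<^sup>2)
      + \<nu> * (L2_norm_on \<Omega> (sym_grad \<Omega> ?u))\<^sup>2
      + \<delta>\<rho> / (2 * \<Delta>t) *
          ((L2_norm_on B (?D n))\<^sup>2 - (L2_norm_on B (\<lambda>s. (X n s - X (n - 1) s) /\<^sub>R \<Delta>t))\<^sup>2)
      + (elastic_energy B W (X (n + 1)) - elastic_energy B W (X n)) / \<Delta>t
    \<le> 0"
    using balance by simp
qed

end
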